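(* Let $D\subset\mathbb{C}^n$ be an open invariant set, $f\in\mathcal{S}(\Omega_D)$ and fix $H\in\mathcal{P}(n)$. Suppose that there exist functions $\{h_K\}_{K\subset H}$ such that $h_K\in\mathcal{S}_{c,H}(\Omega_D)$ for every $K\subset H$ and $$f(x)=\sum_{K\subset H}(-1)^{|H\setminus K|}\left[(\overline{x})_{H\setminus K}\odot h_K\right](x)\qquad\forall x\in\Omega_D.$$ Then $h_K=\mathcal{S}^H_K(f)$ (on $\Omega_{D_H}$) for every $K\subset H$.
   Context: Sets and products. $\mathbb{H}$ denotes the quaternions, $\mathbb{S}_\mathbb{H}=\{J\in\mathbb{H}: J^2=-1\}$, $\mathcal{P}(n)$ is the power set of $\{1,\dots,n\}$, and $H^c=\{1,\dots,n\}\setminus H$. For $K=\{k_1<\dots<k_p\}$ and quaternions $q_k$, $q_K:=q_{k_1}\cdots q_{k_p}$ (increasing order), $q_\emptyset:=1$. For $z\in\mathbb{C}^n$ write $z_h=\alpha_h+i\beta_h$ with $\alpha_h,\beta_h\in\mathbb{R}$, and let $\overline z^h$ be $z$ with $z_h$ replaced by $\overline{z_h}$. Stem and slice functions. $D\subset\mathbb{C}^n$ is invariant if $z\in D\iff\overline z^h\in D$ for all $h$. Let $\{e_K\}_{K\in\mathcal{P}(n)}$ be a basis of $\mathbb{R}^{2^n}$, $e_\emptyset=1$, $e_h:=e_{\{h\}}$. A stem function on $D$ is a continuous $F=\sum_{K\in\mathcal{P}(n)}e_KF_K:D\to\mathbb{H}\otimes\mathbb{R}^{2^n}$ ($F_K$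 $\mathbb{H}$-valued) with $F_K(\overline z^h)=(-1)^{|K\cap\{h\}|}F_K(z)$ for all $K,h$. The circularization of $D$ is $\Omega_D=\{(\alpha_1+J_1\beta_1,\dots,\alpha_n+J_n\beta_n): (\alpha_1+i\beta_1,\dots,\alpha_n+i\beta_n)\in D,\ J_1,\dots,J_n\in\mathbb{S}_\mathbb{H}\}$. $F$ induces the slice function $f=\mathcal{I}(F):\Omega_D\to\mathbb{H}$, $f(x)=\sum_{K}J_KF_K(z)$ for $x=(\alpha_h+J_h\beta_h)_h$, $z=(\alpha_h+i\beta_h)_h$; the stem function $F$ is determined by $f$. $\mathcal{S}(\Omega_D)$ is the set of slice functions on $\Omega_D$. Product: $(F\otimes G)(z)=\sum_{H,K}(-1)^{|H\cap K|}e_{K\Delta H}F_K(z)G_H(z)$ ($\Delta$ = symmetric difference) and $\mathcal{I}(F)\odot\mathcal{I}(G):=\mathcal{I}(F\otimes G)$. The coordinate function $x_j$ is the slice function induced by $Z_j(z)=\alpha_j+e_j\beta_j$, its conjugate $\overline x_j$ is induced by $\overline Z_j(z)=\alpha_j-e_j\beta_j$; $x_K$ and $(\overline x)_K$ are the ordered products of the $x_k$, resp. $\overline x_k$, $k\in K$. Circularity. A function $g\in\mathcal{S}(\Omega_D)$ is circular w.r.t. $x_h$ if, for every $y\in\Omega_D$, the function $x\mapsto g(y_1,\dots,y_{h-1},x,y_{h+1},\dots,y_n)$ is constant on every sphere $\{\alpha+J\beta:J\in\mathbb{S}_\mathbb{H}\}$ contained in its domain. $\mathcal{S}_{c,H}(\Omega_D)$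 is the set of slice functions circular w.r.t. $x_h$ for every $h\in H$. Spherical derivatives and components. For $H\in\mathcal{P}(n)$ let $D_H=\{z\in D:\beta_h\ne0\ \forall h\in H\}$, $\Omega_{D_H}$ its circularization, and for $f=\mathcal{I}(F)\in\mathcal{S}(\Omega_D)$ let $f'_{s,H}=\mathcal{I}(F'_H)\in\mathcal{S}(\Omega_{D_H})$, where $F'_H(z)=\big(\prod_{h\in H}\beta_h\big)^{-1}\sum_{K\subset H^c}e_KF_{K\cup H}(z)$. For $K\subset H$ define $\mathcal{S}^H_K(f):=(x_K\odot f)'_{s,H}$ on $\Omega_{D_H}$; in particular $\mathcal{S}^\emptyset_\emptyset(f)=f$. *)

theory Defs
  imports "HOL-Analysis.Analysis"
begin

section \<open>Quaternions\<close>

datatype quat = Quat (qRe: real) (qI: real) (qJ: real) (qK: real)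

lemma quat_eq_iff: "x = y \<longleftrightarrow> qRe x = qRe y \<and> qI x = qI y \<and> qJ x = qJ y \<and> qK x = qK y"
  by (auto intro: quat.expand)

instantiation quat :: ring_1
begin

definition "0 = Quat 0 0 0 0"
definition "1 = Quat 1 0 0 0"
definition "x + y = Quat (qRe x + qRe y) (qI x + qI y) (qJ x + qJ y) (qK x + qK y)"
definition "- x = Quat (- qRe x) (- qI x) (- qJ x) (- qK x)"
definition "x - y = Quat (qRe x - qRe y) (qI x - qI y) (qJ x - qJ y) (qK x - qK y)"
definition "x * y = Quat
  (qRe x * qRe y - qI x * qI y - qJ x * qJ y - qK x * qK y)
  (qRe x * qI y + qI x * qRe y + qJ x * qK y - qK x * qJ y)
  (qRe x * qJ y - qI x * qK y + qJ x * qRe y + qK x * qI y)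
  (qRe x * qK y + qI x * qJ y - qJ x * qI y + qK x * qRe y)"

lemmas quat_ring_defs =
  zero_quat_def one_quat_def plus_quat_def uminus_quat_def minus_quat_def times_quat_def

instance
  by standard (simp_all add: quat_ring_defs algebra_simps)

end

instantiation quat :: real_algebra_1
begin

definition "r *\<^sub>R x = Quat (r * qRe x) (r * qI x) (r * qJ x) (r * qK x)"

instance
  by standard (simp_all add: scaleR_quat_def quat_ring_defs algebra_simps)

end

instantiation quat :: real_inner
begin

definition inner_quat :: "quat \<Rightarrow> quat \<Rightarrow> real" where
  "inner_quat x y = qRe x * qRe y + qI x * qI y + qJ x * qJ y + qK x * qK y"
definition norm_quat :: "quat \<Rightarrow> real" where
  "norm_quat x = sqrt ((qRe x)\<^sup>2 + (qI x)\<^sup>2 + (qJ x)\<^sup>2 + (qK x)\<^sup>2)"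
definition sgn_quat :: "quat \<Rightarrow> quat" where
  "sgn_quat x = x /\<^sub>R norm x"
definition dist_quat :: "quat \<Rightarrow> quat \<Rightarrow> real" where
  "dist_quat x y = norm (x - y)"
definition uniformity_quat :: "(quat \<times> quat) filter" where
  "uniformity_quat = (INF e\<in>{0 <..}. principal {(x, y). dist x y < e})"
definition open_quat :: "quat set \<Rightarrow> bool" where
  "open_quat U \<longleftrightarrow> (\<forall>x\<in>U. eventually (\<lambda>(x', y). x' = x \<longrightarrow> y \<in> U) uniformity)"

instance
proof
  fix x y z :: quat and r :: real
  show "inner x x = 0 \<longleftrightarrow> x = 0"
  proof
    assume "inner x x = 0"
    then have "(qRe x)\<^sup>2 + (qI x)\<^sup>2 + ((qJ x)\<^sup>2 + (qK x)\<^sup>2) = 0"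
      by (simp add: inner_quat_def power2_eq_square)
    then show "x = 0"
      by (simp add: add_nonneg_eq_0_iff quat_eq_iff zero_quat_def)
  qed (simp add: inner_quat_def zero_quat_def)
qed (simp_all add: inner_quat_def norm_quat_def sgn_quat_def dist_quat_def uniformity_quat_def
      open_quat_def plus_quat_def scaleR_quat_def algebra_simps power2_eq_square)

end

lemma norm_sq_quat: "(norm x)\<^sup>2 = (qRe x)\<^sup>2 + (qI x)\<^sup>2 + (qJ x)\<^sup>2 + (qK x)\<^sup>2" for x :: quat
  by (simp add: norm_quat_def)

instantiation quat :: real_div_algebra
begin

definition inverse_quat :: "quat \<Rightarrow> quat" where
  "inverse_quat x = Quat (qRe x) (- qI x) (- qJ x) (- qK x) /\<^sub>R (norm x)\<^sup>2"
definition divide_quat :: "quat \<Rightarrow> quat \<Rightarrow> quat" where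
  "x div (y::quat) = x * inverse y"

instance
proof
  fix x y :: quat
  show "x div y = x * inverse y"
    by (simp add: divide_quat_def)
  show "inverse (0::quat) = 0"
    by (simp add: inverse_quat_def zero_quat_def scaleR_quat_def)
  assume "x \<noteq> 0"
  then have nz: "(norm x)\<^sup>2 \<noteq> 0"
    by simp
  show "inverse x * x = 1" "x * inverse x = 1"
    using nz unfolding inverse_quat_def norm_sq_quat
    by (simp_all add: times_quat_def one_quat_def scaleR_quat_def divide_simps)
       (simp_all add: power2_eq_square)
qed

end

instance quat :: real_normed_div_algebra
proof
  fix x y :: quat
  have "(norm (x * y))\<^sup>2 = (norm x * norm y)\<^sup>2"
    unfolding power_mult_distrib norm_sq_quat by (simp add: times_quat_def) algebra
  then show "norm (x * y) = norm x * norm y"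
    by simp
qed

definition imag_units :: "quat set" where
  "imag_units = {J. J\<^sup>2 = - 1}"

text \<open>
  The index set \<open>{1, \<dots>, n}\<close> is a finite linearly ordered type \<^typ>\<open>'n\<close>; its order is the one
  in which quaternionic products are taken.
\<close>

type_synonym 'n cspace = "(complex, 'n) vec"
type_synonym 'n qspace = "(quat, 'n) vec"

definition ord_prod :: "'n::{finite,linorder} qspace \<Rightarrow> 'n set \<Rightarrow> quat" where
  "ord_prod q K = prod_list (map (\<lambda>k. q $ k) (sorted_list_of_set K))"

lemma imag_unitsD:
  assumes "J \<in> imag_units"
  shows "qRe J = 0" "norm J = 1"
proof -
  have J: "J * J = - 1"
    using assms by (simp add: imag_units_def power2_eq_square)
  have "norm J * norm J = 1"
    using arg_cong[OF J, of norm] by (simp add: norm_mult)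
  then show 1: "norm J = 1"
    by (metis abs_norm_cancel abs_square_eq_1 power2_eq_square)
  have "(qRe J)\<^sup>2 - (qI J)\<^sup>2 - (qJ J)\<^sup>2 - (qK J)\<^sup>2 = - 1"
    using J by (simp add: quat_eq_iff times_quat_def one_quat_def uminus_quat_def power2_eq_square)
  moreover have "(qRe J)\<^sup>2 + (qI J)\<^sup>2 + (qJ J)\<^sup>2 + (qK J)\<^sup>2 = 1"
    using 1 norm_sq_quat[of J] by simp
  ultimately have "(qRe J)\<^sup>2 = 0"
    by linarith
  then show "qRe J = 0"
    by simp
qed

lemma qRe_simps [simp]:
  "qRe (x + y) = qRe x + qRe y" "qRe (of_real r) = r" "qRe (x * of_real r) = qRe x * r"
  by (simp_all add: plus_quat_def of_real_def scaleR_quat_def one_quat_def times_quat_def)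

lemma ord_prod_scale:
  assumes "\<And>k. k \<in> K \<Longrightarrow> J' $ k = e k *\<^sub>R J $ k"
  shows "ord_prod J' K = (\<Prod>k\<in>K. e k) *\<^sub>R ord_prod J K"
proof -
  have *: "prod_list (map (\<lambda>k. e k *\<^sub>R J $ k) ks)
      = prod_list (map e ks) *\<^sub>R prod_list (map (\<lambda>k. J $ k) ks)" for ks
    by (induction ks) simp_all
  have "ord_prod J' K = prod_list (map (\<lambda>k. e k *\<^sub>R J $ k) (sorted_list_of_set K))"
    unfolding ord_prod_def by (intro arg_cong[of _ _ prod_list] map_cong) (simp_all add: assms)
  also have "\<dots> = prod_list (map e (sorted_list_of_set K)) *\<^sub>R ord_prod J K"
    unfolding * ord_prod_def ..
  also have "prod_list (map e (sorted_list_of_set K)) = (\<Prod>k\<in>K. e k)"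
    by (subst prod.distinct_set_conv_list[symmetric]) simp_all
  finally show ?thesis .
qed

lemma norm_ord_prod:
  assumes "\<forall>h. J $ h \<in> imag_units"
  shows "norm (ord_prod J K) = 1"
proof -
  have "norm (prod_list (map (\<lambda>k. J $ k) ks)) = 1" for ks
    using assms by (induction ks) (simp_all add: norm_mult imag_unitsD)
  then show ?thesis
    by (simp add: ord_prod_def)
qed

lemma prod_sign: "(\<Prod>k\<in>K. if k \<in> S then - 1 else 1 :: real) = (- 1) ^ card (K \<inter> S)"
  for K :: "'a::finite set"
  by (simp add: prod.If_cases)


section \<open>Stem functions and slice functions\<close>

definition conj_at :: "'n \<Rightarrow> 'n::finite cspace \<Rightarrow> 'n cspace" where
  "conj_at h z = (\<chi> i. if i = h then cnj (z $ i) else z $ i)"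

definition invariant :: "'n::finite cspace set \<Rightarrow> bool" where
  "invariant D \<longleftrightarrow> (\<forall>h z. z \<in> D \<longleftrightarrow> conj_at h z \<in> D)"

definition slice_point :: "'n::finite cspace \<Rightarrow> 'n qspace \<Rightarrow> 'n qspace" where
  "slice_point z J = (\<chi> h. of_real (Re (z $ h)) + J $ h * of_real (Im (z $ h)))"

definition circularization :: "'n::finite cspace set \<Rightarrow> 'n qspace set" where
  "circularization D = {slice_point z J | z J. z \<in> D \<and> (\<forall>h. J $ h \<in> imag_units)}"

text \<open>
  The tensor product of the quaternions with \<open>\<real>\<close> to the power \<open>2\<^sup>n\<close> is the space of quaternionic
  vectors indexed by subsets of the index type: \<open>F z $ K\<close> is the component \<open>F\<^sub>K(z)\<close>, and
  \<open>axis K q\<close> is \<open>e\<^sub>K q\<close>.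
\<close>

type_synonym 'n stem = "'n cspace \<Rightarrow> (quat, 'n set) vec"

definition stem_function :: "'n::finite cspace set \<Rightarrow> 'n stem \<Rightarrow> bool" where
  "stem_function D F \<longleftrightarrow> continuous_on D F \<and>
     (\<forall>z\<in>D. \<forall>K h. F (conj_at h z) $ K = (- 1) ^ card (K \<inter> {h}) * F z $ K)"

lemma stem_function_zero:
  assumes "stem_function D F" "z \<in> D" "h \<in> K" "Im (z $ h) = 0"
  shows "F z $ K = 0"
proof -
  have "conj_at h z = z"
    using assms(4) by (simp add: conj_at_def vec_eq_iff complex_eq_iff)
  then have "F z $ K = (- 1) ^ card (K \<inter> {h}) * F z $ K"
    using assms(1,2) unfolding stem_function_def by metis
  then have "F z $ K = - F z $ K"
    using assms(3) by simp
  then show ?thesis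
    by (metis add.inverse_inverse neg_eq_iff_add_eq_0 scaleR_half_double scaleR_zero_right)
qed

lemma stem_function_conj:
  assumes "invariant D" "stem_function D F" "z \<in> D" "finite S"
  defines "w \<equiv> \<lambda>S. \<chi> i. if i \<in> S then cnj (z $ i) else z $ i"
  shows "w S \<in> D \<and> F (w S) $ K = (- 1) ^ card (K \<inter> S) * F z $ K"
  using assms(4)
proof induction
  case empty
  then show ?case
    using assms(3) by (simp add: w_def)
next
  case (insert h S)
  have w: "w (insert h S) = conj_at h (w S)"
    using insert by (simp add: w_def conj_at_def vec_eq_iff)
  have "w (insert h S) \<in> D"
    using insert assms(1) unfolding w invariant_def by blast
  moreover have "F (w (insert h S)) $ K = (- 1) ^ card (K \<inter> {h}) * F (w S) $ K"
    using insert assms(2) unfolding w stem_function_def by blast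
  moreover have "K \<inter> insert h S = (K \<inter> {h}) \<union> (K \<inter> S)"
    by blast
  then have "card (K \<inter> insert h S) = card (K \<inter> {h}) + card (K \<inter> S)"
    using insert by (subst card_Un_disjoint[symmetric]) auto
  ultimately show ?case
    using insert by (simp add: power_add mult.assoc)
qed

lemma slice_value_unique:
  assumes "invariant D" "stem_function D F" "z \<in> D"
    and J: "\<forall>h. J $ h \<in> imag_units" and J': "\<forall>h. J' $ h \<in> imag_units"
    and eq: "slice_point z J = slice_point w J'"
  shows "ord_prod J' K * F w $ K = ord_prod J K * F z $ K"
proof -
  have h: "of_real (Re (z $ h)) + J $ h * of_real (Im (z $ h))
      = of_real (Re (w $ h)) + J' $ h * of_real (Im (w $ h))" for h
    using eq by (simp add: slice_point_def vec_eq_iff)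
  have re: "Re (z $ h) = Re (w $ h)" for h
    using arg_cong[OF h, of qRe h] J J' by (simp add: imag_unitsD)
  have im: "J $ h * of_real (Im (z $ h)) = J' $ h * of_real (Im (w $ h))" for h
    using h re by simp
  have ab: "\<bar>Im (z $ h)\<bar> = \<bar>Im (w $ h)\<bar>" for h
    using arg_cong[OF im, of norm h] J J' by (simp add: norm_mult imag_unitsD)
  then have ab: "Im (w $ h) = Im (z $ h) \<or> Im (w $ h) = - Im (z $ h)" for h
    by (metis abs_eq_iff)
  define S where "S = {h. Im (w $ h) = - Im (z $ h)}"
  have w: "w = (\<chi> i. if i \<in> S then cnj (z $ i) else z $ i)"
    using re ab by (auto simp: vec_eq_iff complex_eq_iff S_def)
  have wD: "w \<in> D" and Fw: "F w $ K = (- 1) ^ card (K \<inter> S) * F z $ K"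
    using stem_function_conj[OF assms(1-3), of S K] unfolding w by auto
  show ?thesis
  proof (cases "\<exists>h\<in>K. Im (z $ h) = 0")
    case True
    then have "F z $ K = 0"
      using stem_function_zero[OF assms(2,3)] by blast
    then show ?thesis
      using Fw by simp
  next
    case False
    have "J' $ k = (if k \<in> S then - 1 else 1) *\<^sub>R J $ k" if "k \<in> K" for k
    proof -
      have nz: "Im (z $ k) \<noteq> 0"
        using False that by blast
      show ?thesis
      proof (cases "k \<in> S")
        case True
        then have "(J $ k + J' $ k) * of_real (Im (z $ k)) = 0"
          using im[of k] by (simp add: S_def distrib_right)
        then have "J $ k + J' $ k = 0"
          using nz by simp
        then show ?thesis
          using True by (simp add: add_eq_0_iff)
      next
        case False
        then have "Im (w $ k) = Im (z $ k)"
          using ab[of k] by (auto simp: S_def)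
        then show ?thesis
          using im[of k] nz False by simp
      qed
    qed
    then have "ord_prod J' K = (- 1) ^ card (K \<inter> S) *\<^sub>R ord_prod J K"
      using ord_prod_scale[of K J' _ J] by (simp add: prod_sign[symmetric])
    then show ?thesis
      unfolding Fw by (cases "even (card (K \<inter> S))") simp_all
  qed
qed

text \<open>
  Functions on a circularization are represented by total functions whose values off that set are
  irrelevant. For a stem function on \<open>D\<close>, the value described below exists and is unique at every
  point of the circularization of \<open>D\<close>; see \<open>induced_slice_point\<close>.
\<close>

definition induced ::
  "'n::{finite,linorder} cspace set \<Rightarrow> 'n stem \<Rightarrow> 'n qspace \<Rightarrow> quat" where
  "induced D F x = (THE q. \<exists>z\<in>D. \<exists>J. (\<forall>h. J $ h \<in> imag_units) \<and> x = slice_point z J \<and>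
                              q = (\<Sum>K\<in>UNIV. ord_prod J K * F z $ K))"

lemma induced_slice_point:
  assumes "invariant D" "stem_function D F" "z \<in> D" "\<forall>h. J $ h \<in> imag_units"
  shows "induced D F (slice_point z J) = (\<Sum>K\<in>UNIV. ord_prod J K * F z $ K)"
  unfolding induced_def
proof (rule the_equality)
  fix q
  assume "\<exists>w\<in>D. \<exists>J'. (\<forall>h. J' $ h \<in> imag_units) \<and> slice_point z J = slice_point w J' \<and>
            q = (\<Sum>K\<in>UNIV. ord_prod J' K * F w $ K)"
  then show "q = (\<Sum>K\<in>UNIV. ord_prod J K * F z $ K)"
    using slice_value_unique[OF assms] by auto
qed (use assms in blast)

definition induces ::
  "'n::{finite,linorder} cspace set \<Rightarrow> 'n stem \<Rightarrow> ('n qspace \<Rightarrow> quat) \<Rightarrow> bool" where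
  "induces D F f \<longleftrightarrow> stem_function D F \<and> (\<forall>x\<in>circularization D. f x = induced D F x)"

definition slice_functions ::
  "'n::{finite,linorder} cspace set \<Rightarrow> ('n qspace \<Rightarrow> quat) set" where
  "slice_functions D = {f. \<exists>F. induces D F f}"

lemma slice_coefficients_zero:
  fixes C :: "'n::{finite,linorder} set \<Rightarrow> quat"
  assumes "\<And>J. \<forall>h. J $ h \<in> imag_units \<Longrightarrow> (\<Sum>K\<in>UNIV. ord_prod J K * C K) = 0"
  shows "C M = 0"
proof -
  have *: "\<forall>J M. (\<forall>h. J $ h \<in> imag_units) \<longrightarrow> (\<Sum>L | L \<inter> S = M. ord_prod J L * C L) = 0"
    if "finite S" for S
    using that
  proof induction
    case empty
    show ?case
    proof (intro allI impI)
      fix J :: "'n qspace" and M :: "'n set"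
      assume "\<forall>h. J $ h \<in> imag_units"
      then show "(\<Sum>L | L \<inter> {} = M. ord_prod J L * C L) = 0"
        using assms[of J] by (cases "M = {}") simp_all
    qed
  next
    case (insert h S)
    show ?case
    proof (intro allI impI)
      fix J :: "'n qspace" and M :: "'n set"
      assume J: "\<forall>h. J $ h \<in> imag_units"
      define J' where "J' = (\<chi> i. (if i \<in> {h} then - 1 else 1) *\<^sub>R J $ i)"
      have J': "\<forall>h. J' $ h \<in> imag_units"
        using J by (auto simp: J'_def imag_units_def)
      define T where "T h' = (\<Sum>L | L \<inter> S = M - {h} \<and> (h \<in> L \<longleftrightarrow> h'). ord_prod J L * C L)" for h'
      define T' where "T' h' = (\<Sum>L | L \<inter> S = M - {h} \<and> (h \<in> L \<longleftrightarrow> h'). ord_prod J' L * C L)" for h'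
      have split: "(\<Sum>L | L \<inter> S = M - {h}. g L) = (\<Sum>L | L \<inter> S = M - {h} \<and> (h \<in> L \<longleftrightarrow> True). g L)
          + (\<Sum>L | L \<inter> S = M - {h} \<and> (h \<in> L \<longleftrightarrow> False). g L)" for g :: "'n set \<Rightarrow> quat"
        by (subst sum.union_disjoint[symmetric]) (auto intro: arg_cong2[of _ _ _ _ sum])
      have sgn: "ord_prod J' L = (if h \<in> L then - 1 else 1) *\<^sub>R ord_prod J L" for L
        using ord_prod_scale[of L J' "\<lambda>i. if i \<in> {h} then - 1 else 1" J]
        by (simp add: J'_def prod_sign)
      have "T' True = - T True" "T' False = T False"
        unfolding T_def T'_def by (simp_all add: sgn sum_negf[symmetric])
      moreover have "T True + T False = 0" "T' True + T' False = 0"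
        using insert.IH J J' unfolding T_def T'_def split[symmetric] by blast+
      ultimately have T: "T True = 0" "T False = 0"
        by (simp_all add: add_eq_0_iff2)
           (metis add.inverse_inverse neg_eq_iff_add_eq_0 scaleR_half_double scaleR_zero_right)+
      show "(\<Sum>L | L \<inter> insert h S = M. ord_prod J L * C L) = 0"
      proof (cases "M \<subseteq> insert h S")
        case True
        then have "{L. L \<inter> insert h S = M} = {L. L \<inter> S = M - {h} \<and> (h \<in> L \<longleftrightarrow> h \<in> M)}"
          using insert.hyps by blast
        then show ?thesis
          using T unfolding T_def by (cases "h \<in> M") simp_all
      next
        case False
        then have "{L. L \<inter> insert h S = M} = {}"
          by blast
        then show ?thesis
          by simp
      qed
    qed
  qed
  define J :: "'n qspace" where "J = (\<chi> i. Quat 0 1 0 0)"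
  have J: "\<forall>h. J $ h \<in> imag_units"
    by (simp add: J_def imag_units_def power2_eq_square quat_ring_defs)
  have "ord_prod J M * C M = 0"
    using *[of UNIV] J by simp
  moreover have "ord_prod J M \<noteq> 0"
    using norm_ord_prod[OF J, of M] by auto
  ultimately show ?thesis
    by simp
qed

lemma induces_unique:
  assumes "invariant D" "induces D F f" "induces D G f" "z \<in> D"
  shows "F z = G z"
proof -
  have "(\<Sum>K\<in>UNIV. ord_prod J K * (F z $ K - G z $ K)) = 0" if J: "\<forall>h. J $ h \<in> imag_units" for J
  proof -
    have "slice_point z J \<in> circularization D"
      using assms(4) J by (auto simp: circularization_def)
    then have "induced D F (slice_point z J) = induced D G (slice_point z J)"
      using assms(2,3) unfolding induces_def by metis
    then show ?thesis
      using induced_slice_point[OF assms(1) _ assms(4) J] assms(2,3)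
      by (simp add: induces_def right_diff_distrib sum_subtractf)
  qed
  then have "F z $ K - G z $ K = 0" for K
    by (rule slice_coefficients_zero[where C = "\<lambda>K. F z $ K - G z $ K"])
  then show ?thesis
    by (simp add: vec_eq_iff)
qed

text \<open>The stem function of a slice function is unique on \<open>D\<close>; see \<open>induces_unique\<close>.\<close>

definition stem_of ::
  "'n::{finite,linorder} cspace set \<Rightarrow> ('n qspace \<Rightarrow> quat) \<Rightarrow> 'n stem" where
  "stem_of D f = (SOME F. induces D F f)"

definition stem_mult :: "'n::finite stem \<Rightarrow> 'n stem \<Rightarrow> 'n stem" where
  "stem_mult F G z =
     (\<Sum>H\<in>UNIV. \<Sum>K\<in>UNIV. axis (sym_diff K H) ((- 1) ^ card (H \<inter> K) * (F z $ K * G z $ H)))"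

definition slice_mult ::
  "'n::{finite,linorder} cspace set \<Rightarrow> ('n qspace \<Rightarrow> quat) \<Rightarrow> ('n qspace \<Rightarrow> quat) \<Rightarrow> 'n qspace \<Rightarrow> quat"
  where "slice_mult D f g = induced D (stem_mult (stem_of D f) (stem_of D g))"

definition coord :: "'n::{finite,linorder} cspace set \<Rightarrow> 'n \<Rightarrow> 'n qspace \<Rightarrow> quat" where
  "coord D j = induced D
     (\<lambda>z. axis {} (of_real (Re (z $ j))) + axis {j} (of_real (Im (z $ j))))"

definition coord_conj :: "'n::{finite,linorder} cspace set \<Rightarrow> 'n \<Rightarrow> 'n qspace \<Rightarrow> quat" where
  "coord_conj D j = induced D
     (\<lambda>z. axis {} (of_real (Re (z $ j))) - axis {j} (of_real (Im (z $ j))))"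

text \<open>
  The ordered products \<open>x\<^sub>K\<close> and their conjugate analogues are slice products. As the factors are
  taken in increasing order, they agree on the circularization with the pointwise products.
\<close>

definition slice_prod_list ::
  "'n::{finite,linorder} cspace set \<Rightarrow> ('n qspace \<Rightarrow> quat) list \<Rightarrow> 'n qspace \<Rightarrow> quat" where
  "slice_prod_list D fs = foldr (slice_mult D) fs (\<lambda>_. 1)"

definition coord_prod ::
  "'n::{finite,linorder} cspace set \<Rightarrow> 'n set \<Rightarrow> 'n qspace \<Rightarrow> quat" where
  "coord_prod D K = slice_prod_list D (map (coord D) (sorted_list_of_set K))"

definition coord_conj_prod ::
  "'n::{finite,linorder} cspace set \<Rightarrow> 'n set \<Rightarrow> 'n qspace \<Rightarrow> quat" where
  "coord_conj_prod D K = slice_prod_list D (map (coord_conj D) (sorted_list_of_set K))"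


section \<open>Circularity, spherical derivatives and spherical components\<close>

definition qsphere :: "real \<Rightarrow> real \<Rightarrow> quat set" where
  "qsphere \<alpha> \<beta> = {of_real \<alpha> + J * of_real \<beta> | J. J \<in> imag_units}"

definition subst_at :: "'n \<Rightarrow> 'n::finite qspace \<Rightarrow> quat \<Rightarrow> 'n qspace" where
  "subst_at h y x = (\<chi> i. if i = h then x else y $ i)"

definition circular_wrt ::
  "'n::{finite,linorder} cspace set \<Rightarrow> 'n \<Rightarrow> ('n qspace \<Rightarrow> quat) \<Rightarrow> bool" where
  "circular_wrt D h g \<longleftrightarrow>
     (\<forall>y\<in>circularization D. \<forall>\<alpha> \<beta>. qsphere \<alpha> \<beta> \<subseteq> {x. subst_at h y x \<in> circularization D}
        \<longrightarrow> (\<lambda>x. g (subst_at h y x)) constant_on qsphere \<alpha> \<beta>)"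

definition circular_slice_functions ::
  "'n set \<Rightarrow> 'n::{finite,linorder} cspace set \<Rightarrow> ('n qspace \<Rightarrow> quat) set" where
  "circular_slice_functions H D = {g \<in> slice_functions D. \<forall>h\<in>H. circular_wrt D h g}"

definition nonreal_part :: "'n set \<Rightarrow> 'n::finite cspace set \<Rightarrow> 'n cspace set" where
  "nonreal_part H D = {z \<in> D. \<forall>h\<in>H. Im (z $ h) \<noteq> 0}"

definition spherical_stem :: "'n set \<Rightarrow> 'n::finite stem \<Rightarrow> 'n stem" where
  "spherical_stem H F z =
     inverse (\<Prod>h\<in>H. Im (z $ h)) *\<^sub>R (\<Sum>K\<in>Pow (- H). axis K (F z $ (K \<union> H)))"

definition spherical_derivative ::
  "'n::{finite,linorder} cspace set \<Rightarrow> 'n set \<Rightarrow> ('n qspace \<Rightarrow> quat) \<Rightarrow> 'n qspace \<Rightarrow> quat" where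
  "spherical_derivative D H f = induced (nonreal_part H D) (spherical_stem H (stem_of D f))"

definition spherical_component ::
  "'n::{finite,linorder} cspace set \<Rightarrow> 'n set \<Rightarrow> 'n set \<Rightarrow> ('n qspace \<Rightarrow> quat) \<Rightarrow> 'n qspace \<Rightarrow> quat"
  where "spherical_component D H K f = spherical_derivative D H (slice_mult D (coord_prod D K) f)"

end

theory Submission
  imports Defs
begin

text \<open>
  Everything is read off from stem functions, which determine the slice functions that they induce.
  Write \<open>G\<^sup>K\<close> for the stem function of \<open>h K\<close> and \<open>z\<^sub>k = \<alpha>\<^sub>k + i \<beta>\<^sub>k\<close>.

  Two facts about supports drive the proof. First, circularity with respect to every variable in \<open>H\<close>
  forces \<open>G\<^sup>K\<^sub>L = 0\<close> whenever \<open>L\<close> meets \<open>H\<close> (\<open>circular_stem_eq_0\<close>). Second, the stem function of an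
  ordered product of coordinates, or of their conjugates, over a set \<open>M\<close> is supported on subsets of \<open>M\<close>
  and has real coefficients, each of which is a product of one local factor per variable
  (\<open>coord_coeff\<close>). In the given decomposition of \<open>f\<close>, the conjugate coordinates over \<open>H - K\<close> and the
  function \<open>h K\<close> therefore have stem functions supported on disjoint sets of variables, so that each
  component of their product is a single term without a sign (\<open>stem_mult_nth_separated\<close>).

  Hence, for \<open>L\<close> disjoint from \<open>H\<close>, the component of index \<open>L \<union> H\<close> of the stem function of \<open>x\<^sub>K \<odot> f\<close> is a
  real linear combination of the quaternions \<open>G\<^sup>K\<^sup>'\<^sub>L\<close>, with \<open>K'\<close> running over the subsets of \<open>H\<close>.
  Its coefficients are sums over sets \<open>Q\<close> of products of local factors, so they are products of
  two-term sums, one for each variable. For \<open>k\<close> in \<open>H\<close> this sum is \<open>\<beta>\<^sub>k\<close> if \<open>k\<close> lies in both or neither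
  of \<open>K\<close> and \<open>K'\<close>, and cancels otherwise (\<open>coord_coeff_orthogonality\<close>). Only \<open>K' = K\<close> survives, with
  coefficient the product of the \<open>\<beta>\<^sub>k\<close> over \<open>H\<close>, which the spherical derivative divides out.
\<close>

section \<open>Slice functions and their stem functions\<close>
lemma minus_one_power_mult: "(- 1) ^ m * q = ((- 1) ^ m :: real) *\<^sub>R q" for q :: quat
  by (cases "even m") simp_all

lemma induces_iff:
  assumes "invariant D"
  shows "induces D F f \<longleftrightarrow> stem_function D F \<and>
    (\<forall>z\<in>D. \<forall>J. (\<forall>h. J $ h \<in> imag_units) \<longrightarrow>
       f (slice_point z J) = (\<Sum>K\<in>UNIV. ord_prod J K * F z $ K))"
  using induced_slice_point[OF assms] unfolding induces_def circularization_def by fastforce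

lemma induces_slice_point:
  assumes "invariant D" "induces D F f" "z \<in> D" "\<forall>h. J $ h \<in> imag_units"
  shows "f (slice_point z J) = (\<Sum>K\<in>UNIV. ord_prod J K * F z $ K)"
  using assms induces_iff by blast

lemma induces_induced: "stem_function D F \<Longrightarrow> induces D F (induced D F)"
  by (simp add: induces_def)

lemma induced_cong: "(\<And>z. z \<in> D \<Longrightarrow> F z = G z) \<Longrightarrow> induced D F = induced D G"
  unfolding induced_def by (intro ext arg_cong[of _ _ The] bex_cong) simp_all

lemma induces_stem_of: "induces D F f \<Longrightarrow> induces D (stem_of D f) f"
  unfolding stem_of_def by (rule someI[where P = "\<lambda>F. induces D F f"])

lemma stem_of_eq:
  assumes "invariant D" "induces D F f" "z \<in> D"
  shows "stem_of D f z = F z"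
  using induces_unique[OF assms(1) induces_stem_of[OF assms(2)] assms(2,3)] .

lemma stem_function_subset: "stem_function D F \<Longrightarrow> D' \<subseteq> D \<Longrightarrow> stem_function D' F"
  unfolding stem_function_def by (meson continuous_on_subset subsetD)

lemma induces_scaleR:
  assumes "invariant D" "induces D F f"
  shows "induces D (\<lambda>z. c *\<^sub>R F z) (\<lambda>x. c *\<^sub>R f x)"
  using assms(2) unfolding induces_iff[OF assms(1)] stem_function_def
  by (auto simp: scaleR_sum_right intro!: continuous_intros)

lemma induces_sum:
  assumes "invariant D" "\<And>i. i \<in> I \<Longrightarrow> induces D (F i) (f i)"
  shows "induces D (\<lambda>z. \<Sum>i\<in>I. F i z) (\<lambda>x. \<Sum>i\<in>I. f i x)"
proof -
  have "(\<Sum>i\<in>I. \<Sum>K\<in>UNIV. ord_prod J K * F i z $ K)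
      = (\<Sum>K\<in>UNIV. ord_prod J K * (\<Sum>i\<in>I. F i z $ K))" for J z
    by (subst sum.swap) (simp add: sum_distrib_left)
  moreover have "stem_function D (\<lambda>z. \<Sum>i\<in>I. F i z)"
    unfolding stem_function_def
  proof (intro conjI ballI allI)
    show "continuous_on D (\<lambda>z. \<Sum>i\<in>I. F i z)"
      using assms(2) by (intro continuous_on_sum) (simp add: induces_def stem_function_def)
    fix z K h
    assume "z \<in> D"
    then have "F i (conj_at h z) $ K = (- 1) ^ card (K \<inter> {h}) * F i z $ K" if "i \<in> I" for i
      using assms(2)[OF that] unfolding induces_def stem_function_def by blast
    then show "(\<Sum>i\<in>I. F i (conj_at h z)) $ K = (- 1) ^ card (K \<inter> {h}) * (\<Sum>i\<in>I. F i z) $ K"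
      by (simp add: sum_distrib_left)
  qed
  ultimately show ?thesis
    using induces_slice_point[OF assms] by (simp add: induces_iff[OF assms(1)])
qed

lemma induces_cong_on:
  assumes "induces D F f" "\<And>x. x \<in> circularization D \<Longrightarrow> f x = g x"
  shows "induces D F g"
  using assms unfolding induces_def by metis

lemma invariant_nonreal_part:
  assumes "invariant D"
  shows "invariant (nonreal_part H D)"
proof -
  have "Im (conj_at h z $ i) = 0 \<longleftrightarrow> Im (z $ i) = 0" for h z and i :: 'a
    by (simp add: conj_at_def)
  then show ?thesis
    using assms by (simp add: invariant_def nonreal_part_def)
qed

section \<open>The product of stem functions\<close>

text \<open>
  In the component \<open>M\<close> the pair of indices \<open>(Q, R)\<close> contributes exactly when \<open>sym_diff Q R = M\<close>, that
  is when \<open>R = sym_diff Q M\<close>; a single sum remains. The sign is a real scalar, so that it commutes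
  with the quaternionic factors.
\<close>
lemma stem_mult_nth:
  "stem_mult F G z $ M =
     (\<Sum>Q\<in>UNIV. ((- 1) ^ card (sym_diff Q M \<inter> Q) :: real) *\<^sub>R (F z $ Q * G z $ sym_diff Q M))"
proof -
  have *: "M = sym_diff Q R \<longleftrightarrow> R = sym_diff Q M" for Q R
    by blast
  have "stem_mult F G z $ M = (\<Sum>Q\<in>UNIV. \<Sum>R\<in>UNIV. if R = sym_diff Q M
      then (- 1) ^ card (R \<inter> Q) * (F z $ Q * G z $ R) else 0)"
    unfolding stem_mult_def by (subst sum.swap) (simp add: axis_def *)
  then show ?thesis
    by (simp add: minus_one_power_mult)
qed

text \<open>
  If one factor involves only the units \<open>e\<^sub>k\<close> with \<open>k\<close> in \<open>A\<close> and the other only the remaining ones,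
  then \<open>M\<close> splits uniquely as \<open>sym_diff Q R\<close> along \<open>A\<close>, and no unit gets squared.
\<close>
lemma stem_mult_nth_separated:
  assumes F: "\<And>Q. \<not> Q \<subseteq> A \<Longrightarrow> F z $ Q = 0"
    and G: "\<And>R. R \<inter> A \<noteq> {} \<Longrightarrow> G z $ R = 0"
  shows "stem_mult F G z $ M = F z $ (M \<inter> A) * G z $ (M - A)"
proof -
  have "Q = M \<inter> A" if "F z $ Q * G z $ sym_diff Q M \<noteq> 0" for Q
  proof -
    have "Q \<subseteq> A"
      using that F[of Q] by (cases "Q \<subseteq> A") simp_all
    moreover have "sym_diff Q M \<inter> A = {}"
      using that G[of "sym_diff Q M"] by (cases "sym_diff Q M \<inter> A = {}") simp_all
    ultimately show ?thesis
      by blast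
  qed
  then have "stem_mult F G z $ M
      = (\<Sum>Q\<in>{M \<inter> A}. ((- 1) ^ card (sym_diff Q M \<inter> Q) :: real) *\<^sub>R (F z $ Q * G z $ sym_diff Q M))"
    unfolding stem_mult_nth by (intro sum.mono_neutral_right) auto
  moreover have "sym_diff (M \<inter> A) M = M - A" "(M - A) \<inter> (M \<inter> A) = {}"
    by blast+
  ultimately show ?thesis
    by simp
qed

lemma stem_function_mult:
  assumes "stem_function D F" "stem_function D G"
  shows "stem_function D (stem_mult F G)"
proof -
  have FG: "continuous_on D F" "continuous_on D G"
    using assms by (simp_all add: stem_function_def)
  have "continuous_on D (\<lambda>z. stem_mult F G z $ M)" for M
    unfolding stem_mult_nth by (intro continuous_intros FG)
  then have "continuous_on D (\<lambda>z. \<chi> M. stem_mult F G z $ M)"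
    by (rule continuous_on_vec_lambda)
  moreover have "stem_mult F G (conj_at h z) $ M = (- 1) ^ card (M \<inter> {h}) * stem_mult F G z $ M"
    if "z \<in> D" for z M h
  proof -
    have "F (conj_at h z) $ Q * G (conj_at h z) $ sym_diff Q M
        = ((- 1) ^ card (M \<inter> {h}) :: real) *\<^sub>R (F z $ Q * G z $ sym_diff Q M)" for Q
    proof -
      have "F (conj_at h z) $ Q = (- 1) ^ card (Q \<inter> {h}) * F z $ Q"
        "G (conj_at h z) $ sym_diff Q M = (- 1) ^ card (sym_diff Q M \<inter> {h}) * G z $ sym_diff Q M"
        using assms that unfolding stem_function_def by blast+
      then show ?thesis
        by (cases "h \<in> Q"; cases "h \<in> M") simp_all
    qed
    then show ?thesis
      unfolding stem_mult_nth minus_one_power_mult by (simp add: scaleR_sum_right mult.commute)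
  qed
  ultimately show ?thesis
    by (simp add: stem_function_def)
qed

lemma induces_slice_mult:
  assumes "invariant D" "induces D F f" "induces D G g"
  shows "induces D (stem_mult F G) (slice_mult D f g)"
proof -
  have "slice_mult D f g = induced D (stem_mult F G)"
    unfolding slice_mult_def
    by (intro induced_cong) (simp add: stem_mult_def stem_of_eq[OF assms(1,2)] stem_of_eq[OF assms(1,3)])
  then show ?thesis
    using assms(2,3) by (simp add: induces_induced stem_function_mult induces_def)
qed

section \<open>Products of coordinates\<close>

text \<open>
  Expanding the product of \<open>\<alpha>\<^sub>k + s e\<^sub>k \<beta>\<^sub>k\<close> over \<open>k \<in> K\<close>, this is the coefficient of \<open>e\<^sub>L\<close>: the sign
  \<open>s = 1\<close> gives the coordinates and \<open>s = - 1\<close> their conjugates. The product extends over all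
  variables, with the factors \<open>0\<close> and \<open>1\<close> off \<open>K\<close> encoding the condition \<open>L \<subseteq> K\<close>; identities between
  coefficients can then be checked one variable at a time.
\<close>
definition coord_coeff :: "real \<Rightarrow> 'n::finite set \<Rightarrow> 'n cspace \<Rightarrow> 'n set \<Rightarrow> real" where
  "coord_coeff s K z L = (\<Prod>k\<in>UNIV.
     if k \<in> K then (if k \<in> L then s * Im (z $ k) else Re (z $ k)) else (if k \<in> L then 0 else 1))"

definition coord_stem :: "real \<Rightarrow> 'n::finite set \<Rightarrow> 'n stem" where
  "coord_stem s K z = (\<chi> L. of_real (coord_coeff s K z L))"

lemma coord_coeff_eq_0: "\<not> L \<subseteq> K \<Longrightarrow> coord_coeff s K z L = 0"
  unfolding coord_coeff_def by (subst prod_zero_iff) auto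

lemma stem_function_coord_stem: "stem_function D (coord_stem s K)"
proof -
  have "continuous_on D (\<lambda>z. if k \<in> K then (if k \<in> L then s * Im (z $ k) else Re (z $ k))
      else (if k \<in> L then 0 else 1))" for k L
    by (cases "k \<in> K"; cases "k \<in> L") (simp_all add: continuous_intros)
  then have "continuous_on D (\<lambda>z. coord_coeff s K z L)" for L
    unfolding coord_coeff_def by (intro continuous_on_prod)
  then have "continuous_on D (coord_stem s K)"
    unfolding coord_stem_def by (intro continuous_intros)
  moreover have "coord_coeff s K (conj_at h z) L = (- 1) ^ card (L \<inter> {h}) * coord_coeff s K z L"
    for h z L
  proof -
    have "coord_coeff s K (conj_at h z) L
        = (\<Prod>k\<in>UNIV. if k \<in> L \<inter> {h} then - 1 else 1) * coord_coeff s K z L"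
      unfolding coord_coeff_def prod.distrib[symmetric]
      by (intro prod.cong) (auto simp: conj_at_def)
    then show ?thesis
      using prod_sign[of "L \<inter> {h}" UNIV] by simp
  qed
  ultimately show ?thesis
    by (simp add: stem_function_def coord_stem_def)
qed

lemma stem_mult_coord_stem:
  assumes "A \<inter> B = {}"
  shows "stem_mult (coord_stem s A) (coord_stem s B) = coord_stem s (A \<union> B)"
proof -
  have "coord_coeff s A z (M \<inter> A) * coord_coeff s B z (M - A) = coord_coeff s (A \<union> B) z M" for z M
    unfolding coord_coeff_def prod.distrib[symmetric] using assms by (intro prod.cong) auto
  moreover have "stem_mult (coord_stem s A) (coord_stem s B) z $ M
      = coord_stem s A z $ (M \<inter> A) * coord_stem s B z $ (M - A)" for z M
    using assms by (intro stem_mult_nth_separated)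
      (auto simp: coord_stem_def intro!: coord_coeff_eq_0)
  ultimately show ?thesis
    by (simp add: vec_eq_iff fun_eq_iff coord_stem_def flip: of_real_mult)
qed

lemma coord_stem_empty: "coord_stem s {} z = axis {} 1"
  by (auto simp: vec_eq_iff coord_stem_def coord_coeff_def axis_def)

lemma coord_stem_singleton:
  "coord_stem s {j} z = axis {} (of_real (Re (z $ j))) + axis {j} (of_real (s * Im (z $ j)))"
proof -
  have "coord_coeff s {j} z {j} = s * Im (z $ j)" "coord_coeff s {j} z {} = Re (z $ j)"
    by (simp_all add: coord_coeff_def cong: if_cong)
  moreover have "coord_coeff s {j} z L = 0" if "L \<noteq> {}" "L \<noteq> {j}" for L
    using that by (intro coord_coeff_eq_0) auto
  ultimately show ?thesis
    by (auto simp: vec_eq_iff coord_stem_def axis_def)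
qed

text \<open>
  Distinctness keeps the set of variables of each factor disjoint from that of the remaining product.
\<close>
lemma induces_slice_prod_list:
  assumes D: "invariant D" and c: "\<And>j. induces D (coord_stem s {j}) (c j)" and "distinct ks"
  shows "induces D (coord_stem s (set ks)) (slice_prod_list D (map c ks))"
  using \<open>distinct ks\<close>
proof (induction ks)
  case Nil
  have "ord_prod J {} = 1" for J :: "'a qspace"
    by (simp add: ord_prod_def)
  then have "(\<Sum>K\<in>UNIV. ord_prod J K * axis {} 1 $ K) = 1" for J :: "'a qspace"
    by (simp add: axis_def if_distrib cong: if_cong)
  moreover have "stem_function D (\<lambda>_. axis {} 1)"
    using stem_function_coord_stem[of D s "{}"] by (simp only: coord_stem_empty[abs_def])
  ultimately show ?case
    by (simp add: induces_iff[OF D] coord_stem_empty slice_prod_list_def)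
next
  case (Cons k ks)
  then have "induces D (stem_mult (coord_stem s {k}) (coord_stem s (set ks)))
      (slice_mult D (c k) (slice_prod_list D (map c ks)))"
    by (intro induces_slice_mult D c) simp
  then show ?case
    using Cons.prems by (simp add: stem_mult_coord_stem slice_prod_list_def)
qed

lemma induces_coord_prod:
  assumes "invariant D"
  shows "induces D (coord_stem 1 K) (coord_prod D K)"
proof -
  have "coord D j = induced D (coord_stem 1 {j})" for j
    unfolding coord_def coord_stem_singleton[abs_def] mult_1 ..
  then have "induces D (coord_stem 1 {j}) (coord D j)" for j
    using induces_induced[OF stem_function_coord_stem] by metis
  from induces_slice_prod_list[OF assms this, of "sorted_list_of_set K"] show ?thesis
    by (simp add: coord_prod_def)
qed

lemma induces_coord_conj_prod:
  assumes "invariant D"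
  shows "induces D (coord_stem (- 1) K) (coord_conj_prod D K)"
proof -
  have "axis {} a + axis {j} (- b) = axis {} a - axis {j} b" for a b :: quat and j :: 'a
    by (simp add: vec_eq_iff axis_def)
  then have "coord_conj D j = induced D (coord_stem (- 1) {j})" for j
    unfolding coord_conj_def coord_stem_singleton[abs_def] by simp
  then have "induces D (coord_stem (- 1) {j}) (coord_conj D j)" for j
    using induces_induced[OF stem_function_coord_stem] by metis
  from induces_slice_prod_list[OF assms this, of "sorted_list_of_set K"] show ?thesis
    by (simp add: coord_conj_prod_def)
qed

section \<open>Circular slice functions\<close>

text \<open>
  Replacing \<open>J\<^sub>h\<close> by \<open>- J\<^sub>h\<close> moves a point within a sphere in the variable \<open>h\<close>, and so fixes the value
  of \<open>g\<close>; but it changes the sign of exactly the terms \<open>J\<^sub>K G\<^sub>K\<close> with \<open>h \<in> K\<close>. Their sum therefore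
  vanishes for every choice of \<open>J\<close>, which forces each such \<open>G\<^sub>K\<close> to vanish.
\<close>
lemma circular_stem_eq_0:
  assumes D: "invariant D" and G: "induces D G g" and circ: "circular_wrt D h g"
    and z: "z \<in> D" and "h \<in> L"
  shows "G z $ L = 0"
proof -
  define C where "C K = (if h \<in> K then G z $ K else 0)" for K
  have "(\<Sum>K\<in>UNIV. ord_prod J K * C K) = 0" if J: "\<forall>i. J $ i \<in> imag_units" for J
  proof -
    define x where "x = slice_point z J"
    define J' where "J' I = (\<chi> i. if i = h then I else J $ i)" for I
    have J': "\<forall>i. J' I $ i \<in> imag_units" if "I \<in> imag_units" for I
      using that J by (simp add: J'_def)
    have sub: "subst_at h x (of_real (Re (z $ h)) + I * of_real (Im (z $ h))) = slice_point z (J' I)" for I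
      by (simp add: x_def J'_def subst_at_def slice_point_def vec_eq_iff)
    have "x \<in> circularization D"
      using z J by (auto simp: x_def circularization_def)
    moreover have "qsphere (Re (z $ h)) (Im (z $ h)) \<subseteq> {q. subst_at h x q \<in> circularization D}"
      using z J' by (fastforce simp: qsphere_def sub circularization_def)
    ultimately have "(\<lambda>q. g (subst_at h x q)) constant_on qsphere (Re (z $ h)) (Im (z $ h))"
      using circ unfolding circular_wrt_def by blast
    then obtain c where "\<forall>q\<in>qsphere (Re (z $ h)) (Im (z $ h)). g (subst_at h x q) = c"
      unfolding constant_on_def by blast
    then have c: "g (slice_point z (J' I)) = c" if "I \<in> imag_units" for I
      using that unfolding sub[symmetric] qsphere_def by blast
    \<comment> \<open>compare the points of the sphere with units \<open>J\<^sub>h\<close> and \<open>- J\<^sub>h\<close>\<close>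
    have Jh: "J $ h \<in> imag_units" "- J $ h \<in> imag_units" "J' (J $ h) = J"
      using J by (auto simp: imag_units_def J'_def vec_eq_iff)
    have "J' (- J $ h) $ k = (if k \<in> {h} then - 1 else 1) *\<^sub>R J $ k" for k
      by (simp add: J'_def)
    then have sgn: "ord_prod (J' (- J $ h)) K = (if h \<in> K then - 1 else 1) *\<^sub>R ord_prod J K" for K
      using ord_prod_scale[of K "J' (- J $ h)" "\<lambda>k. if k \<in> {h} then - 1 else 1" J]
      by (simp add: prod_sign)
    have "(\<Sum>K\<in>UNIV. ord_prod J K * G z $ K) = (\<Sum>K\<in>UNIV. ord_prod (J' (- J $ h)) K * G z $ K)"
      using c[of "J $ h"] c[of "- J $ h"] Jh J' J induces_slice_point[OF D G z] by metis
    then have "0 = (\<Sum>K\<in>UNIV. ord_prod J K * G z $ K - ord_prod (J' (- J $ h)) K * G z $ K)"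
      by (simp add: sum_subtractf)
    also have "\<dots> = (\<Sum>K\<in>UNIV. 2 *\<^sub>R (ord_prod J K * C K))"
      by (intro sum.cong) (auto simp: sgn C_def scaleR_2)
    finally show ?thesis
      by (simp flip: scaleR_sum_right)
  qed
  then have "C L = 0"
    by (rule slice_coefficients_zero)
  then show ?thesis
    using \<open>h \<in> L\<close> by (simp add: C_def)
qed

section \<open>Recovering the components\<close>

text \<open>
  This is the expansion of a product of two-term sums, read from right to left, with the choice made
  at \<open>k\<close> recorded as membership in \<open>Q\<close>.
\<close>
lemma sum_over_subsets_prod:
  fixes \<phi> :: "'a::finite \<Rightarrow> bool \<Rightarrow> real"
  shows "(\<Sum>Q\<in>UNIV. \<Prod>k\<in>UNIV. \<phi> k (k \<in> Q)) = (\<Prod>k\<in>UNIV. \<phi> k True + \<phi> k False)"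
proof -
  have "(\<Prod>k\<in>UNIV. \<phi> k (k \<in> Q)) = (\<Prod>k\<in>Q. \<phi> k True) * (\<Prod>k\<in>UNIV - Q. \<phi> k False)" for Q
    by (subst prod.subset_diff[of Q]) (simp_all add: mult.commute)
  then show ?thesis
    by (simp add: prod_add)
qed

text \<open>
  The sum factors over the variables. A variable \<open>k\<close> in \<open>H\<close> contributes \<open>\<beta>\<^sub>k + \<alpha>\<^sub>k \<cdot> 0\<close> if it lies in
  \<open>K\<close> and \<open>K'\<close>, \<open>- \<beta>\<^sub>k \<alpha>\<^sub>k + \<alpha>\<^sub>k \<beta>\<^sub>k = 0\<close> if only in \<open>K\<close>, \<open>0\<close> if only in \<open>K'\<close>, and \<open>\<beta>\<^sub>k\<close> if in
  neither. Variables outside \<open>H\<close> contribute \<open>1\<close>.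
\<close>
lemma coord_coeff_orthogonality:
  assumes "K \<subseteq> H" "K' \<subseteq> H"
  shows "(\<Sum>Q\<in>UNIV. coord_coeff 1 K z Q * ((- 1) ^ card (H - K') * coord_coeff (- 1) (H - K') z (H - Q)))
       = (if K' = K then \<Prod>k\<in>H. Im (z $ k) else 0)"
proof -
  \<comment> \<open>the local factor at \<open>k\<close> of a summand, where \<open>b\<close> stands for \<open>k \<in> Q\<close>\<close>
  define \<phi> where "\<phi> k b =
     (if k \<in> K then if b then Im (z $ k) else Re (z $ k) else if b then 0 else 1) *
     ((if k \<in> H - K' then - 1 else 1) *
      (if k \<in> H - K' then if k \<in> H \<and> \<not> b then - Im (z $ k) else Re (z $ k)
       else if k \<in> H \<and> \<not> b then 0 else 1))" for k b
  have "(- 1) ^ card (H - K') = (\<Prod>k\<in>UNIV. if k \<in> H - K' then - 1 else 1 :: real)"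
    using prod_sign[of "H - K'" UNIV] by simp
  then have "(\<Sum>Q\<in>UNIV. coord_coeff 1 K z Q * ((- 1) ^ card (H - K') * coord_coeff (- 1) (H - K') z (H - Q)))
      = (\<Sum>Q\<in>UNIV. \<Prod>k\<in>UNIV. \<phi> k (k \<in> Q))"
    by (simp add: coord_coeff_def \<phi>_def flip: prod.distrib cong: if_cong)
  also have "\<dots> = (\<Prod>k\<in>UNIV. \<phi> k True + \<phi> k False)"
    by (rule sum_over_subsets_prod)
  also have "\<dots> = (\<Prod>k\<in>UNIV. if k \<in> K \<longleftrightarrow> k \<in> K' then if k \<in> H then Im (z $ k) else 1 else 0)"
    using assms by (intro prod.cong) (auto simp: \<phi>_def)
  also have "\<dots> = (if K' = K then \<Prod>k\<in>H. Im (z $ k) else 0)"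
  proof (cases "K' = K")
    case True
    then show ?thesis
      by (simp add: prod.If_cases)
  next
    case False
    then obtain k where "(k \<in> K) \<noteq> (k \<in> K')"
      by blast
    then show ?thesis
      using False by (simp del: prod_zero_iff) (rule prod_zero, auto)
  qed
  finally show ?thesis .
qed

text \<open>
  Only \<open>Q \<subseteq> K \<subseteq> H\<close> contributes, and for such \<open>Q\<close> the index \<open>sym_diff Q (L \<union> H)\<close> is the complement of
  \<open>Q\<close> in \<open>L \<union> H\<close>, so every sign is \<open>1\<close>.
\<close>
lemma stem_mult_coord_stem_nth_Un:
  assumes "K \<subseteq> H"
  shows "stem_mult (coord_stem s K) F z $ (L \<union> H)
      = (\<Sum>Q\<in>UNIV. coord_coeff s K z Q *\<^sub>R F z $ (L \<union> H - Q))"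
  unfolding stem_mult_nth
proof (intro sum.cong refl)
  fix Q
  show "((- 1) ^ card (sym_diff Q (L \<union> H) \<inter> Q) :: real) *\<^sub>R
      (coord_stem s K z $ Q * F z $ sym_diff Q (L \<union> H)) = coord_coeff s K z Q *\<^sub>R F z $ (L \<union> H - Q)"
  proof (cases "Q \<subseteq> K")
    case True
    then have "sym_diff Q (L \<union> H) = L \<union> H - Q" "(L \<union> H - Q) \<inter> Q = {}"
      using assms by blast+
    then show ?thesis
      by (simp add: coord_stem_def scaleR_conv_of_real)
  qed (simp add: coord_stem_def coord_coeff_eq_0)
qed

lemma spherical_stem_nth:
  "spherical_stem H F z $ L =
     (if L \<inter> H = {} then inverse (\<Prod>h\<in>H. Im (z $ h)) *\<^sub>R F z $ (L \<union> H) else 0)"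
proof -
  have "(\<Sum>K\<in>Pow (- H). axis K (F z $ (K \<union> H)) $ L)
      = (\<Sum>K\<in>Pow (- H). if K = L then F z $ (K \<union> H) else 0)"
    by (intro sum.cong) (auto simp: axis_def)
  then show ?thesis
    by (auto simp: spherical_stem_def)
qed

text \<open>
  The claim at a single point \<open>z\<close>: supports outside \<open>H\<close> for the \<open>G\<^sup>K\<close> reduce each component of \<open>F\<close>
  to a real combination of theirs, and orthogonality of the coefficients isolates \<open>G\<^sup>K\<close>.
\<close>
lemma spherical_stem_of_decomposition:
  assumes G: "\<And>K L. K \<subseteq> H \<Longrightarrow> L \<inter> H \<noteq> {} \<Longrightarrow> G K z $ L = 0"
    and F: "F z = (\<Sum>K\<in>Pow H. (- 1) ^ card (H - K) *\<^sub>R stem_mult (coord_stem (- 1) (H - K)) (G K) z)"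
    and nz: "\<forall>h\<in>H. Im (z $ h) \<noteq> 0" and K: "K \<subseteq> H"
  shows "spherical_stem H (stem_mult (coord_stem 1 K) F) z = G K z"
proof -
  let ?\<beta> = "\<Prod>h\<in>H. Im (z $ h)"
  have FM: "F z $ M = (\<Sum>K\<in>Pow H. ((- 1) ^ card (H - K) * coord_coeff (- 1) (H - K) z (M \<inter> H))
      *\<^sub>R G K z $ (M - H))" for M
  proof -
    have "stem_mult (coord_stem (- 1) (H - K)) (G K) z $ M
        = coord_coeff (- 1) (H - K) z (M \<inter> H) *\<^sub>R G K z $ (M - H)" if "K \<subseteq> H" for K
    proof -
      have "coord_stem (- 1) (H - K) z $ Q = 0" if "\<not> Q \<subseteq> H" for Q
        using that by (auto simp: coord_stem_def intro!: coord_coeff_eq_0)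
      from stem_mult_nth_separated[of H "coord_stem (- 1) (H - K)" z "G K" M, OF this G[OF that]]
      show ?thesis
        by (simp add: coord_stem_def scaleR_conv_of_real)
    qed
    then show ?thesis
      by (simp add: F)
  qed
  have "stem_mult (coord_stem 1 K) F z $ (L \<union> H) = ?\<beta> *\<^sub>R G K z $ L" if L: "L \<inter> H = {}" for L
  proof -
    have "coord_coeff 1 K z Q *\<^sub>R F z $ (L \<union> H - Q) = (\<Sum>K'\<in>Pow H.
        (coord_coeff 1 K z Q * ((- 1) ^ card (H - K') * coord_coeff (- 1) (H - K') z (H - Q))) *\<^sub>R G K' z $ L)"
      for Q
    proof (cases "Q \<subseteq> K")
      case True
      then have "L \<union> H - Q - H = L" "(L \<union> H - Q) \<inter> H = H - Q"
        using K L by blast+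
      then show ?thesis
        by (simp add: FM scaleR_sum_right)
    qed (simp add: coord_coeff_eq_0)
    then have "stem_mult (coord_stem 1 K) F z $ (L \<union> H) = (\<Sum>Q\<in>UNIV. \<Sum>K'\<in>Pow H.
        (coord_coeff 1 K z Q * ((- 1) ^ card (H - K') * coord_coeff (- 1) (H - K') z (H - Q))) *\<^sub>R G K' z $ L)"
      by (simp only: stem_mult_coord_stem_nth_Un[OF K])
    also have "\<dots> = (\<Sum>K'\<in>Pow H. (if K' = K then ?\<beta> else 0) *\<^sub>R G K' z $ L)"
      by (subst sum.swap)
         (auto simp flip: scaleR_sum_left simp: coord_coeff_orthogonality[OF K] intro!: sum.cong)
    also have "\<dots> = ?\<beta> *\<^sub>R G K z $ L"
      using K by (simp add: if_distrib[of "\<lambda>c. c *\<^sub>R _"] cong: if_cong)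
    finally show ?thesis .
  qed
  then show ?thesis
    using nz G[OF K] by (auto simp: vec_eq_iff spherical_stem_nth)
qed

theorem proposition3p2:
  fixes D :: "'n::{finite,linorder} cspace set"
    and f :: "'n qspace \<Rightarrow> quat"
    and H :: "'n set"
    and h :: "'n set \<Rightarrow> 'n qspace \<Rightarrow> quat"
  assumes "open D"
    and "invariant D"
    and "f \<in> slice_functions D"
    and "\<forall>K. K \<subseteq> H \<longrightarrow> h K \<in> circular_slice_functions H D"
    and "\<forall>x\<in>circularization D.
           f x = (\<Sum>K\<in>Pow H. (- 1) ^ card (H - K) * slice_mult D (coord_conj_prod D (H - K)) (h K) x)"
  shows "\<forall>K. K \<subseteq> H \<longrightarrow>
           (\<forall>x\<in>circularization (nonreal_part H D). h K x = spherical_component D H K f x)"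
proof (intro allI impI ballI)
  fix K x
  assume K: "K \<subseteq> H" and x: "x \<in> circularization (nonreal_part H D)"
  note D = \<open>invariant D\<close>
  let ?D' = "nonreal_part H D"
  have sub: "?D' \<subseteq> D"
    by (auto simp: nonreal_part_def)
  define G where "G K = stem_of D (h K)" for K
  have G: "induces D (G K) (h K)" if "K \<subseteq> H" for K
    using that assms(4) induces_stem_of
    unfolding G_def circular_slice_functions_def slice_functions_def by blast
  have G0: "G K z $ L = 0" if "K \<subseteq> H" "L \<inter> H \<noteq> {}" "z \<in> D" for K L z
    using circular_stem_eq_0[OF D G] that assms(4) unfolding circular_slice_functions_def by blast
  define F where "F z =
    (\<Sum>K\<in>Pow H. (- 1) ^ card (H - K) *\<^sub>R stem_mult (coord_stem (- 1) (H - K)) (G K) z)" for z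
  have "induces D F (\<lambda>x. \<Sum>K\<in>Pow H.
      (- 1) ^ card (H - K) *\<^sub>R slice_mult D (coord_conj_prod D (H - K)) (h K) x)"
    unfolding F_def
    by (intro induces_sum induces_scaleR induces_slice_mult induces_coord_conj_prod D G) simp
  then have "induces D F f"
    by (rule induces_cong_on) (simp add: assms(5) minus_one_power_mult)
  then have "induces D (stem_mult (coord_stem 1 K) F) (slice_mult D (coord_prod D K) f)"
    by (intro induces_slice_mult induces_coord_prod D)
  then have "spherical_stem H (stem_of D (slice_mult D (coord_prod D K) f)) z = G K z" if "z \<in> ?D'" for z
    using stem_of_eq[OF D, of "stem_mult (coord_stem 1 K) F" _ z] that sub
      spherical_stem_of_decomposition[of H G z F K] G0 F_def K
    by (auto simp: spherical_stem_def nonreal_part_def)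
  then have "spherical_component D H K f = induced ?D' (G K)"
    unfolding spherical_component_def spherical_derivative_def by (rule induced_cong)
  \<comment> \<open>inducing \<open>G K\<close> on \<open>D\<close> and on its nonreal part gives the same value at \<open>x\<close>\<close>
  moreover obtain z J where zJ: "z \<in> ?D'" "\<forall>i. J $ i \<in> imag_units" "x = slice_point z J"
    using x by (auto simp: circularization_def)
  moreover have "stem_function ?D' (G K)"
    using G[OF K] sub stem_function_subset unfolding induces_def by blast
  ultimately show "h K x = spherical_component D H K f x"
    using induces_slice_point[OF D G[OF K]] sub
      induced_slice_point[OF invariant_nonreal_part[OF D], of H "G K" z J] by auto
qed

end
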